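(* Let $R$ be a ring and let $I$ be a finitely generated N-pure ideal of $R$. Then $\sqrt{I}=\sqrt{Ra}$ for some $a\in I$.
   Context: All rings are commutative with identity. $N(R)$ denotes the nilradical of $R$. An ideal $I$ of $R$ is called N-pure if for every $a\in I$ there exists $b\in I$ such that $a(1-b)\in N(R)$. $\sqrt{\cdot}$ denotes the radical of an ideal. *)

theory Defs
  imports "HOL-Algebra.Algebra"
begin

definition nilradical :: "('a, 'm) ring_scheme \<Rightarrow> 'a set"
  where "nilradical R = {x \<in> carrier R. \<exists>n::nat. 0 < n \<and> x [^]\<^bsub>R\<^esub> n = \<zero>\<^bsub>R\<^esub>}"

definition radical_ideal :: "('a, 'm) ring_scheme \<Rightarrow> 'a set \<Rightarrow> 'a set"
  where "radical_ideal R I = {x \<in> carrier R. \<exists>n::nat. 0 < n \<and> x [^]\<^bsub>R\<^esub> n \<in> I}"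

definition finitely_generated_ideal :: "('a, 'm) ring_scheme \<Rightarrow> 'a set \<Rightarrow> bool"
  where "finitely_generated_ideal R I \<longleftrightarrow>
    ideal I R \<and> (\<exists>S. finite S \<and> S \<subseteq> carrier R \<and> I = Idl\<^bsub>R\<^esub> S)"

definition N_pure_ideal :: "('a, 'm) ring_scheme \<Rightarrow> 'a set \<Rightarrow> bool"
  where "N_pure_ideal R I \<longleftrightarrow>
    ideal I R \<and> (\<forall>a\<in>I. \<exists>b\<in>I. a \<otimes>\<^bsub>R\<^esub> (\<one>\<^bsub>R\<^esub> \<ominus>\<^bsub>R\<^esub> b) \<in> nilradical R)"

end

theory Submission
  imports Defs
begin

text \<open>
  Every element of a pure ideal \<open>I\<close> is fixed by multiplication with some \<open>b \<in> I\<close>, and finitely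
  many elements have a common such multiplier: if \<open>a\<close> serves some of them and \<open>b\<close> serves
  one more, then \<open>1 - (1 - a)(1 - b)\<close> lies in \<open>I\<close> and serves all of them. If \<open>I\<close> is
  finitely generated, this gives \<open>I = Ra\<close>.

  The same argument works modulo nilpotents. Applied to generators of \<open>I\<close>, it yields
  \<open>a \<in> I\<close> with \<open>s(1 - a)\<close> nilpotent for each generator \<open>s\<close>
  (\<open>N_pure_ideal_common_multiplier\<close>). Then \<open>s = sa + s(1 - a)\<close> is a multiple of \<open>a\<close> plus a nilpotent
  element, so it lies in \<open>\<surd>(Ra)\<close>. Since \<open>\<surd>(Ra)\<close> is an ideal (\<open>ideal_radical_ideal\<close>), it contains
  all of \<open>I\<close>, and therefore \<open>\<surd>I\<close>; the other inclusion is clear from \<open>a \<in> I\<close>.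
\<close>

text \<open>
  The extra factor \<open>z\<close> replaces the binomial theorem: since
  \<open>(x + y)\<^sup>n\<^sup>+\<^sup>m z\<close> is the sum of \<open>(x + y)\<^sup>n\<^sup>+\<^sup>m\<^sup>-\<^sup>1 xz\<close> and \<open>(x + y)\<^sup>n\<^sup>+\<^sup>m\<^sup>-\<^sup>1 yz\<close>, induction on the
  exponents applies, with \<open>xz\<close> and \<open>yz\<close> in place of \<open>z\<close>.
\<close>

lemma (in cring) add_pow_mult_mem_ideal:
  assumes J: "ideal J R" and x: "x \<in> carrier R" and y: "y \<in> carrier R"
    and z: "z \<in> carrier R"
    and "x [^] (n::nat) \<otimes> z \<in> J" "y [^] (m::nat) \<otimes> z \<in> J"
  shows "(x \<oplus> y) [^] (n + m) \<otimes> z \<in> J"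
  using z assms(5,6)
proof (induction "n + m" arbitrary: n m z rule: less_induct)
  case less
  interpret J: ideal J R by (rule J)
  note [simp] = x y \<open>z \<in> carrier R\<close>
  show ?case
  proof (cases "n = 0 \<or> m = 0")
    case True
    then have "z \<in> J" using less.prems by auto
    then show ?thesis by (intro J.I_l_closed) auto
  next
    case False
    then obtain k l where n: "n = Suc k" and m: "m = Suc l"
      by (meson not0_implies_Suc)
    have "x [^] k \<otimes> (x \<otimes> z) \<in> J"
      using less.prems(2) by (simp add: n m_assoc)
    moreover have "y [^] m \<otimes> (x \<otimes> z) \<in> J"
      using J.I_l_closed[OF less.prems(3), of x] by (simp add: m_lcomm)
    ultimately have xz: "(x \<oplus> y) [^] (k + m) \<otimes> (x \<otimes> z) \<in> J"
      by (intro less.hyps) (auto simp: n)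
    have "x [^] n \<otimes> (y \<otimes> z) \<in> J"
      using J.I_l_closed[OF less.prems(2), of y] by (simp add: m_lcomm)
    moreover have "y [^] l \<otimes> (y \<otimes> z) \<in> J"
      using less.prems(3) by (simp add: m m_assoc)
    ultimately have yz: "(x \<oplus> y) [^] (n + l) \<otimes> (y \<otimes> z) \<in> J"
      by (intro less.hyps) (auto simp: m)
    have "(x \<oplus> y) [^] (n + m) \<otimes> z
      = (x \<oplus> y) [^] (k + m) \<otimes> (x \<otimes> z) \<oplus> (x \<oplus> y) [^] (n + l) \<otimes> (y \<otimes> z)"
      by (simp add: n m m_assoc l_distr r_distr)
    then show ?thesis using J.a_closed[OF xz yz] by simp
  qed
qed

lemma (in cring) ideal_radical_ideal:
  assumes J: "ideal J R"
  shows "ideal (radical_ideal R J) R"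
proof -
  interpret J: ideal J R by (rule J)
  have add: "x \<oplus> y \<in> radical_ideal R J"
    if "x \<in> radical_ideal R J" "y \<in> radical_ideal R J" for x y
  proof -
    from that obtain n m :: nat where
      "x \<in> carrier R" "y \<in> carrier R" "0 < n" "x [^] n \<in> J" "y [^] m \<in> J"
      unfolding radical_ideal_def by blast
    then show ?thesis
      using add_pow_mult_mem_ideal[OF J, of x y \<one> n m]
      unfolding radical_ideal_def by (auto intro!: exI[of _ "n + m"])
  qed
  have mult: "r \<otimes> x \<in> radical_ideal R J"
    if "x \<in> radical_ideal R J" "r \<in> carrier R" for r x
    using that unfolding radical_ideal_def
    by (auto simp: nat_pow_distrib intro!: J.I_l_closed)
  have sub: "radical_ideal R J \<subseteq> carrier R"
    unfolding radical_ideal_def by auto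
  have zero: "\<zero> \<in> radical_ideal R J"
    unfolding radical_ideal_def by (auto intro!: exI[of _ "1::nat"])
  have "\<ominus> x \<in> radical_ideal R J" if "x \<in> radical_ideal R J" for x
    using mult[OF that, of "\<ominus> \<one>"] that sub by (auto simp: l_minus)
  then have "subgroup (radical_ideal R J) (add_monoid R)"
    by (intro add.subgroupI) (use sub zero add in \<open>auto simp: a_inv_def\<close>)
  moreover have "x \<otimes> r \<in> radical_ideal R J"
    if "x \<in> radical_ideal R J" "r \<in> carrier R" for r x
    using mult[OF that] that sub by (auto simp: m_comm)
  ultimately show ?thesis
    using mult by (intro idealI ring_axioms)
qed

lemma (in cring) subset_radical_ideal:
  assumes "ideal J R"
  shows "J \<subseteq> radical_ideal R J"
  using ideal.Icarr[OF assms] unfolding radical_ideal_def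
  by (auto intro!: exI[of _ "1::nat"])

lemma radical_ideal_mono:
  "J \<subseteq> K \<Longrightarrow> radical_ideal R J \<subseteq> radical_ideal R K"
  unfolding radical_ideal_def by blast

lemma (in cring) radical_ideal_idem:
  "radical_ideal R (radical_ideal R J) \<subseteq> radical_ideal R J"
proof
  fix x assume "x \<in> radical_ideal R (radical_ideal R J)"
  then obtain n m :: nat where
    "x \<in> carrier R" "0 < n" "0 < m" "(x [^] n) [^] m \<in> J"
    unfolding radical_ideal_def by blast
  then show "x \<in> radical_ideal R J"
    unfolding radical_ideal_def by (auto simp: nat_pow_pow intro!: exI[of _ "n * m"])
qed

lemma nilradical_eq_radical_zero: "nilradical R = radical_ideal R {\<zero>\<^bsub>R\<^esub>}"
  unfolding nilradical_def radical_ideal_def by simp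

lemma (in cring) ideal_nilradical: "ideal (nilradical R) R"
  unfolding nilradical_eq_radical_zero by (intro ideal_radical_ideal zeroideal)

text \<open>
  When one more element \<open>t\<close>, with its own multiplier \<open>b\<close>, joins those served by \<open>a\<close>, the new
  multiplier \<open>c\<close> is chosen so that \<open>1 - c = (1 - a)(1 - b)\<close>: each residue \<open>s(1 - c)\<close> is then a
  multiple of a residue already known to be nilpotent.
\<close>

lemma (in cring) N_pure_ideal_common_multiplier:
  assumes pure: "N_pure_ideal R I" and "finite S" "S \<subseteq> I"
  shows "\<exists>a\<in>I. \<forall>s\<in>S. s \<otimes> (\<one> \<ominus> a) \<in> nilradical R"
  using assms(2,3)
proof (induction S rule: finite_induct)
  case empty
  have "ideal I R" using pure by (simp add: N_pure_ideal_def)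
  then show ?case
    using additive_subgroup.zero_closed ideal.axioms(1) by fastforce
next
  case (insert t S)
  interpret I: ideal I R using pure by (simp add: N_pure_ideal_def)
  interpret N: ideal "nilradical R" R by (rule ideal_nilradical)
  obtain a where a: "a \<in> I" and Sa: "\<And>s. s \<in> S \<Longrightarrow> s \<otimes> (\<one> \<ominus> a) \<in> nilradical R"
    using insert by auto
  obtain b where b: "b \<in> I" and tb: "t \<otimes> (\<one> \<ominus> b) \<in> nilradical R"
    using pure insert.prems unfolding N_pure_ideal_def by auto
  note [simp] = I.Icarr[OF a] I.Icarr[OF b]
  define c where "c = a \<oplus> b \<otimes> (\<one> \<ominus> a)"
  have c: "c \<in> I"
    unfolding c_def using a b by (intro I.a_closed I.I_r_closed) auto
  have one_minus_c: "\<one> \<ominus> c = (\<one> \<ominus> a) \<otimes> (\<one> \<ominus> b)"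
    unfolding c_def using I.Icarr[OF a] I.Icarr[OF b] by algebra
  have "s \<otimes> (\<one> \<ominus> c) \<in> nilradical R" if s: "s \<in> insert t S" for s
  proof (cases "s = t")
    case True
    have "t \<in> carrier R" using insert.prems I.Icarr by auto
    then have "t \<otimes> (\<one> \<ominus> c) = (\<one> \<ominus> a) \<otimes> (t \<otimes> (\<one> \<ominus> b))"
      unfolding one_minus_c by (simp add: m_lcomm)
    then show ?thesis using True N.I_l_closed[OF tb] by simp
  next
    case False
    then have "s \<in> S" using s by simp
    moreover have "s \<in> carrier R" using calculation insert.prems I.Icarr by auto
    then have "s \<otimes> (\<one> \<ominus> c) = s \<otimes> (\<one> \<ominus> a) \<otimes> (\<one> \<ominus> b)"
      unfolding one_minus_c by (simp add: m_assoc)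
    ultimately show ?thesis using N.I_r_closed[OF Sa] by simp
  qed
  then show ?case using c by blast
qed

lemma (in cring) mem_radical_of_nilpotent_residue:
  assumes J: "ideal J R" and a: "a \<in> J" and s: "s \<in> carrier R"
    and nil: "s \<otimes> (\<one> \<ominus> a) \<in> nilradical R"
  shows "s \<in> radical_ideal R J"
proof -
  interpret J: ideal J R by (rule J)
  interpret rad: ideal "radical_ideal R J" R by (rule ideal_radical_ideal[OF J])
  have "nilradical R \<subseteq> radical_ideal R J"
    unfolding nilradical_eq_radical_zero by (intro radical_ideal_mono) simp
  moreover have "s \<otimes> a \<in> radical_ideal R J"
    using subset_radical_ideal[OF J] J.I_l_closed[OF a s] by blast
  ultimately have "s \<otimes> a \<oplus> s \<otimes> (\<one> \<ominus> a) \<in> radical_ideal R J"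
    using nil by (intro rad.a_closed) auto
  moreover have "s \<otimes> a \<oplus> s \<otimes> (\<one> \<ominus> a) = s"
    using s J.Icarr[OF a] by algebra
  ultimately show ?thesis by simp
qed

theorem proposition3p18:
  fixes R (structure) and I :: "'a set"
  assumes "cring R"
    and "ideal I R"
    and "finitely_generated_ideal R I"
    and "N_pure_ideal R I"
  shows "\<exists>a\<in>I. radical_ideal R I = radical_ideal R (PIdl\<^bsub>R\<^esub> a)"
proof -
  interpret cring R by (rule assms(1))
  interpret I: ideal I R by (rule assms(2))
  obtain S where S: "finite S" "S \<subseteq> carrier R" and I_eq: "I = Idl S"
    using assms(3) unfolding finitely_generated_ideal_def by blast
  have "S \<subseteq> I" unfolding I_eq by (rule genideal_self[OF S(2)])
  then obtain a where a: "a \<in> I"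
    and nil: "\<And>s. s \<in> S \<Longrightarrow> s \<otimes> (\<one> \<ominus> a) \<in> nilradical R"
    using N_pure_ideal_common_multiplier[OF assms(4) S(1)] by blast
  have a_carr: "a \<in> carrier R" using a by (rule I.Icarr)
  have Ra: "ideal (PIdl a) R" and a_Ra: "a \<in> PIdl a"
    using a_carr by (auto intro: cgenideal_ideal cgenideal_self)
  have "S \<subseteq> radical_ideal R (PIdl a)"
    using mem_radical_of_nilpotent_residue[OF Ra a_Ra] nil S(2) by blast
  then have "I \<subseteq> radical_ideal R (PIdl a)"
    unfolding I_eq by (intro genideal_minimal ideal_radical_ideal Ra)
  then have "radical_ideal R I \<subseteq> radical_ideal R (PIdl a)"
    using radical_ideal_mono radical_ideal_idem by blast
  moreover have "radical_ideal R (PIdl a) \<subseteq> radical_ideal R I"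
    by (intro radical_ideal_mono cgenideal_minimal assms(2) a)
  ultimately show ?thesis using a by blast
qed

end
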